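(* Let $(\mathfrak{L},[\;,\;])$ be a complex semisimple finite-dimensional Lie algebra. Then there are no non-trivial transposed Poisson algebra structures defined on $\mathfrak{L}$.
   Context: A transposed Poisson algebra structure on a complex Lie algebra $(\mathfrak{L},[\;,\;])$ is a bilinear operation $\cdot$ on $\mathfrak{L}$ such that $(\mathfrak{L},\cdot)$ is commutative and associative (not necessarily unital) and $2z\cdot[x,y]=[z\cdot x,y]+[x,z\cdot y]$ for all $x,y,z\in\mathfrak{L}$. The structure is non-trivial if both operations $\cdot$ and $[\;,\;]$ are not identically zero. *)

theory Defs
  imports Complex_Main
begin

text \<open>
  Algebras live on a whole type of class \<open>ab_group_add\<close>; the complex vector space structure is an
  explicit scalar multiplication, as in the library locale \<open>vector_space\<close>.
\<close>

definition complex_bilinear ::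
  "(complex \<Rightarrow> 'a::ab_group_add \<Rightarrow> 'a) \<Rightarrow> ('a \<Rightarrow> 'a \<Rightarrow> 'a) \<Rightarrow> bool"
  where "complex_bilinear scale f \<longleftrightarrow>
    (\<forall>x. Vector_Spaces.linear scale scale (\<lambda>y. f x y)) \<and>
    (\<forall>y. Vector_Spaces.linear scale scale (\<lambda>x. f x y))"

locale complex_lie_algebra = vector_space scale
  for scale :: "complex \<Rightarrow> 'a::ab_group_add \<Rightarrow> 'a" +
  fixes bracket :: "'a \<Rightarrow> 'a \<Rightarrow> 'a"
  assumes bracket_bilinear: "complex_bilinear scale bracket"
    and bracket_self: "bracket x x = 0"
    and jacobi: "bracket x (bracket y z) + bracket y (bracket z x) + bracket z (bracket x y) = 0"
begin

definition lie_ideal :: "'a set \<Rightarrow> bool"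
  where "lie_ideal I \<longleftrightarrow> subspace I \<and> (\<forall>x. \<forall>y\<in>I. bracket x y \<in> I)"

primrec derived_series :: "'a set \<Rightarrow> nat \<Rightarrow> 'a set"
  where
    "derived_series I 0 = I"
  | "derived_series I (Suc n) =
      span {bracket x y | x y. x \<in> derived_series I n \<and> y \<in> derived_series I n}"

definition solvable :: "'a set \<Rightarrow> bool"
  where "solvable I \<longleftrightarrow> (\<exists>n. derived_series I n = {0})"

text \<open>
  Vanishing radical. The zero algebra counts as semisimple.
\<close>

definition semisimple :: bool
  where "semisimple \<longleftrightarrow> (\<forall>I. lie_ideal I \<and> solvable I \<longrightarrow> I = {0})"

end

locale transposed_poisson_structure = complex_lie_algebra scale bracket
  for scale :: "complex \<Rightarrow> 'a::ab_group_add \<Rightarrow> 'a"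
    and bracket :: "'a \<Rightarrow> 'a \<Rightarrow> 'a" +
  fixes mult :: "'a \<Rightarrow> 'a \<Rightarrow> 'a"
  assumes mult_bilinear: "complex_bilinear scale mult"
    and mult_commute: "mult x y = mult y x"
    and mult_assoc: "mult (mult x y) z = mult x (mult y z)"
    and transposed_leibniz:
      "scale 2 (mult z (bracket x y)) = bracket (mult z x) y + bracket x (mult z y)"
begin

definition nontrivial :: bool
  where "nontrivial \<longleftrightarrow> (\<exists>x y. mult x y \<noteq> 0) \<and> (\<exists>x y. bracket x y \<noteq> 0)"

end

end

theory Submission
  imports Defs "HOL-Computational_Algebra.Fundamental_Theorem_Algebra"
begin

text \<open>
  Write \<open>L\<close> for the Lie algebra. Every multiplication operator \<open>mult z\<close> is a half-derivation of \<open>L\<close>,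
  that is, a linear \<open>D\<close> with \<open>2 D[x,y] = [D x, y] + [x, D y]\<close>. The proof has two halves, each of
  which contradicts semisimplicity by producing a nonzero solvable ideal.

  A half-derivation \<open>D\<close> of a semisimple \<open>L\<close> with \<open>D\<^sup>2 = 0\<close> vanishes
  (\<open>square_zero_half_derivation_vanishes\<close>). If not, choose such a nonzero \<open>D\<close> with the largest kernel
  \<open>K\<close>. For \<open>x\<close> in \<open>K\<close> the map \<open>D \<circ> ad x\<close> is again a half-derivation of square zero, and so is
  \<open>D \<circ> ad x - c D\<close>. Choosing \<open>c\<close> through an eigenvector of \<open>ad x\<close> on the range of \<open>D\<close> enlarges the
  kernel, so this map is zero: each \<open>x\<close> in \<open>K\<close> acts on \<open>L / K\<close> by a scalar \<open>c\<close>
  (\<open>kernel_acts_by_scalar\<close>), and on the range of \<open>D\<close> by \<open>2 c\<close>. The ideal generated by the range has a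
  filtration on whose successive quotients \<open>x\<close> acts by \<open>2 c, 3 c, 4 c, \<dots>\<close>
  (\<open>scalar_action_on_filtration\<close>). None of these multipliers vanishes unless \<open>c\<close> does, and \<open>[y,y] = 0\<close>;
  hence an element \<open>y\<close> of this ideal that lies in \<open>K\<close> has scalar \<open>0\<close>, which keeps the next layer of the
  filtration in \<open>K\<close> (\<open>filtration_acts_trivially\<close>). So the whole ideal acts on itself by strictly lowering
  the filtration, and it is solvable.

  Now \<open>z \<cdot> z \<cdot> L = 0\<close> forces \<open>z \<cdot> L = 0\<close>. If the product is nonzero, choose \<open>w\<close> with \<open>w \<cdot> L \<noteq> 0\<close> and
  with the largest annihilator. The same trick with an eigenvector shows that \<open>w\<close> acts on \<open>w \<cdot> L\<close> by a
  nonzero scalar and that \<open>w \<cdot> L\<close> is a line spanned by an idempotent \<open>e\<close>. The half-derivation rule for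
  \<open>e \<cdot> [e,x]\<close> puts \<open>[e,x]\<close> in the eigenspace of an idempotent operator for the eigenvalue \<open>1/2\<close>.
  Thus \<open>e\<close> is central and spans a nonzero abelian ideal (\<open>no_nontrivial_mult\<close>).
\<close>

section \<open>Finite-dimensional complex linear algebra\<close>

locale finite_dimensional_complex_space = finite_dimensional_vector_space scale Basis
  for scale :: "complex \<Rightarrow> 'a::ab_group_add \<Rightarrow> 'a" and Basis :: "'a set"
begin

abbreviation endomorphism :: "('a \<Rightarrow> 'a) \<Rightarrow> bool"
  where "endomorphism \<equiv> Vector_Spaces.linear scale scale"

lemma endomorphismI:
  assumes "\<And>x y. f (x + y) = f x + f y" "\<And>c x. f (scale c x) = scale c (f x)"
  shows "endomorphism f"
  using assms vector_space_axioms by (auto simp: Vector_Spaces.linear_iff)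

lemma endomorphism_add: "endomorphism f \<Longrightarrow> f (x + y) = f x + f y"
  and endomorphism_scale: "endomorphism f \<Longrightarrow> f (scale c x) = scale c (f x)"
  by (auto simp: Vector_Spaces.linear_iff)

lemma endomorphism_zero: "endomorphism f \<Longrightarrow> f 0 = 0"
  by (metis endomorphism_scale scale_zero_left)

lemma endomorphism_diff: "endomorphism f \<Longrightarrow> f (x - y) = f x - f y"
  by (metis endomorphism_add add_diff_cancel diff_add_cancel)

lemma subspace_kernel: "endomorphism f \<Longrightarrow> subspace {x. f x = 0}"
  by (auto simp: subspace_def endomorphism_add endomorphism_scale endomorphism_zero)

lemma subspace_range: "endomorphism f \<Longrightarrow> subspace (range f)"
  using subspace_UNIV module_hom.subspace_image[of scale scale f UNIV]
  by (simp add: Vector_Spaces.linear_iff_module_hom)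

lemma subspace_dim_less:
  assumes "subspace U" "subspace W" "U \<subset> W"
  shows "dim U < dim W"
  using assms dim_psubset[of U W] span_eq_iff[of U] span_eq_iff[of W] by metis

lemma ascending_chain_stabilizes:
  assumes sub: "\<And>n. subspace (F n)" and mono: "\<And>n. F n \<subseteq> F (Suc n)"
  obtains n where "F (Suc n) = F n"
proof (rule ccontr)
  assume "\<not> thesis"
  then have "F n \<subset> F (Suc n)" for n
    using mono that by blast
  then have less: "dim (F n) < dim (F (Suc n))" for n
    using sub subspace_dim_less by blast
  have "n \<le> dim (F n)" for n
    by (induction n) (use less in \<open>auto simp: Suc_le_eq intro: le_less_trans\<close>)
  from this[of "Suc dimension"] dim_subset_UNIV[of "F (Suc dimension)"] show False
    by simp
qed

text \<open>
  The index type of the operators \<open>T z\<close> is arbitrary, so that the choice can be made both among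
  half-derivations and among elements of an algebra acting by multiplication.
\<close>

lemma maximal_kernel:
  fixes T :: "'b \<Rightarrow> 'a \<Rightarrow> 'a"
  assumes "P u"
  obtains w where "P w" "\<And>z. P z \<Longrightarrow> dim {x. T z x = 0} \<le> dim {x. T w x = 0}"
proof -
  have "\<forall>z. P z \<longrightarrow> dim {x. T z x = 0} < Suc dimension"
    using dim_subset_UNIV by (simp add: less_Suc_eq_le)
  from Lattices_Big.ex_has_greatest_nat[of P, OF assms this] that show thesis
    by blast
qed

text \<open>
  The way maximality is exploited: an operator that kills the kernel of \<open>T w\<close> and one vector more has a
  strictly larger kernel, so it cannot compete. Applied with a \<open>P\<close> that contains the condition
  \<open>T z \<noteq> 0\<close>, this shows that the new operator is zero.
\<close>

lemma kernel_maximal_imp_not: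
  assumes max: "\<And>z. P z \<Longrightarrow> dim {x. T z x = 0} \<le> dim {x. T w x = 0}"
    and w: "endomorphism (T w)" and z: "endomorphism (T z)"
    and sub: "\<And>x. T w x = 0 \<Longrightarrow> T z x = 0" and t: "T z t = 0" "T w t \<noteq> 0"
  shows "\<not> P z"
proof
  assume "P z"
  have "{x. T w x = 0} \<subset> {x. T z x = 0}"
    using sub t by blast
  from subspace_dim_less[OF subspace_kernel[OF w] subspace_kernel[OF z] this] max[OF \<open>P z\<close>]
  show False by simp
qed

text \<open>The vector \<open>p(f) v\<close>, computed by Horner's scheme.\<close>

definition poly_apply :: "('a \<Rightarrow> 'a) \<Rightarrow> 'a \<Rightarrow> complex poly \<Rightarrow> 'a"
  where "poly_apply f v p = fold_coeffs (\<lambda>c w. scale c v + f w) p 0"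

lemma poly_apply_0 [simp]: "poly_apply f v 0 = 0"
  by (simp add: poly_apply_def)

lemma poly_apply_pCons:
  assumes "endomorphism f"
  shows "poly_apply f v (pCons c p) = scale c v + f (poly_apply f v p)"
  using assms
  by (cases "p = 0 \<and> c = 0") (auto simp: poly_apply_def endomorphism_zero)

lemma poly_apply_add:
  assumes f: "endomorphism f"
  shows "poly_apply f v (p + q) = poly_apply f v p + poly_apply f v q"
  by (induction p q rule: poly_induct2)
     (simp_all add: poly_apply_pCons[OF f] endomorphism_add[OF f] scale_left_distrib)

lemma poly_apply_smult:
  assumes f: "endomorphism f"
  shows "poly_apply f v (smult c p) = scale c (poly_apply f v p)"
  by (induction p)
     (simp_all add: poly_apply_pCons[OF f] endomorphism_scale[OF f] scale_right_distrib)

lemma poly_apply_linear_factor: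
  assumes f: "endomorphism f"
  shows "poly_apply f v ([:-a, 1:] * p) = f (poly_apply f v p) - scale a (poly_apply f v p)"
proof -
  have "[:-a, 1:] * p = pCons 0 p + smult (-a) p"
    by simp
  then show ?thesis
    by (simp only: poly_apply_pCons[OF f] poly_apply_add[OF f] poly_apply_smult[OF f]) simp
qed

lemma poly_apply_monom:
  assumes f: "endomorphism f"
  shows "poly_apply f v (monom 1 n) = (f ^^ n) v"
  by (induction n)
     (simp_all add: monom_0 monom_Suc poly_apply_pCons[OF f] endomorphism_zero[OF f])

lemma poly_apply_in:
  assumes f: "endomorphism f" and "subspace S" "\<And>x. x \<in> S \<Longrightarrow> f x \<in> S" "v \<in> S"
  shows "poly_apply f v p \<in> S"
  by (induction p) (use assms in \<open>auto simp: poly_apply_pCons[OF f] subspace_0 subspace_add subspace_scale\<close>)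

text \<open>
  Split off a root \<open>a\<close> of \<open>p = (X - a) q\<close>: either \<open>q(f) v\<close> is an eigenvector for \<open>a\<close>, or \<open>q\<close> is an
  annihilator of smaller degree.
\<close>

lemma eigenvector_of_annihilator:
  assumes f: "endomorphism f" and S: "subspace S" "\<And>x. x \<in> S \<Longrightarrow> f x \<in> S"
    and v: "v \<in> S" "v \<noteq> 0" and p: "p \<noteq> 0" "poly_apply f v p = 0"
  shows "\<exists>a w. w \<in> S \<and> w \<noteq> 0 \<and> f w = scale a w"
  using p
proof (induction "degree p" arbitrary: p)
  case 0
  then obtain c where "p = [:c:]" "c \<noteq> 0"
    by (metis degree_eq_zeroE pCons_0_0)
  with 0 v show ?case
    by (simp add: poly_apply_pCons[OF f] endomorphism_zero[OF f])
next
  case (Suc n)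
  then have "\<not> constant (poly p)"
    by (simp add: constant_degree)
  then obtain a where "poly p a = 0"
    using fundamental_theorem_of_algebra by blast
  then obtain q where q: "p = [:-a, 1:] * q"
    by (auto simp: poly_eq_0_iff_dvd elim: dvdE)
  let ?w = "poly_apply f v q"
  have eigen: "f ?w = scale a ?w"
    using Suc.prems q poly_apply_linear_factor[OF f] by simp
  show ?case
  proof (cases "?w = 0")
    case True
    have "q \<noteq> 0" using q Suc.prems by auto
    then have "degree p = Suc (degree q)"
      unfolding q by (subst degree_mult_eq) auto
    with Suc True \<open>q \<noteq> 0\<close> show ?thesis by simp
  next
    case False
    with eigen poly_apply_in[OF f S v(1)] show ?thesis by blast
  qed
qed

lemma span_iterates_poly:
  assumes f: "endomorphism f"
    and "x \<in> span ((\<lambda>i. (f ^^ i) v) ` {..<n})"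
  shows "\<exists>p. (\<forall>i\<ge>n. coeff p i = 0) \<and> poly_apply f v p = x"
  using assms(2)
proof (induction n arbitrary: x)
  case 0
  then show ?case by (intro exI[of _ 0]) simp
next
  case (Suc n)
  then obtain k where "x - scale k ((f ^^ n) v) \<in> span ((\<lambda>i. (f ^^ i) v) ` {..<n})"
    by (auto simp: lessThan_Suc span_breakdown_eq)
  from Suc.IH[OF this] obtain p where
    p: "\<forall>i\<ge>n. coeff p i = 0" "poly_apply f v p = x - scale k ((f ^^ n) v)"
    by blast
  have "poly_apply f v (p + smult k (monom 1 n)) = x"
    by (simp only: poly_apply_add[OF f] poly_apply_smult[OF f] poly_apply_monom[OF f] p(2)) simp
  then show ?case
    using p(1) by (intro exI[of _ "p + smult k (monom 1 n)"]) auto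
qed

lemma eigenvector_exists:
  assumes f: "endomorphism f" and S: "subspace S" "\<And>x. x \<in> S \<Longrightarrow> f x \<in> S"
    and v: "v \<in> S" "v \<noteq> 0"
  obtains a w where "w \<in> S" "w \<noteq> 0" "f w = scale a w"
proof -
  \<comment> \<open>The iterates of \<open>v\<close> span an increasing chain; where it stops, a monic annihilator appears.\<close>
  let ?F = "\<lambda>n. span ((\<lambda>i. (f ^^ i) v) ` {..<n})"
  obtain n where "?F (Suc n) = ?F n"
    by (rule ascending_chain_stabilizes[of ?F]) (auto intro!: span_mono)
  then have "(f ^^ n) v \<in> ?F n"
    by (metis (no_types, lifting) image_eqI lessI lessThan_iff span_base)
  from span_iterates_poly[OF f this] obtain p where
    p: "\<forall>i\<ge>n. coeff p i = 0" "poly_apply f v p = (f ^^ n) v"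
    by blast
  let ?q = "monom 1 n + smult (-1) p"
  have "coeff ?q n = 1" using p(1) by simp
  then have "?q \<noteq> 0" by force
  moreover have "poly_apply f v ?q = 0"
    by (simp only: poly_apply_add[OF f] poly_apply_smult[OF f] poly_apply_monom[OF f] p(2)) simp
  ultimately show thesis
    using eigenvector_of_annihilator[OF f S v] that by blast
qed

end

section \<open>Square-zero half-derivations\<close>

locale finite_dimensional_lie_algebra =
  complex_lie_algebra scale bracket + finite_dimensional_complex_space scale Basis
  for scale :: "complex \<Rightarrow> 'a::ab_group_add \<Rightarrow> 'a"
    and bracket :: "'a \<Rightarrow> 'a \<Rightarrow> 'a" and Basis :: "'a set"
begin

lemma endomorphism_bracket: "endomorphism (bracket x)"
  and endomorphism_bracket_left: "endomorphism (\<lambda>x. bracket x y)"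
  using bracket_bilinear by (auto simp: complex_bilinear_def)

lemma bracket_simps:
  "bracket (x + y) z = bracket x z + bracket y z"
  "bracket x (y + z) = bracket x y + bracket x z"
  "bracket (x - y) z = bracket x z - bracket y z"
  "bracket x (y - z) = bracket x y - bracket x z"
  "bracket (scale c x) y = scale c (bracket x y)"
  "bracket x (scale c y) = scale c (bracket x y)"
  "bracket 0 x = 0"
  "bracket x 0 = 0"
  by (fact endomorphism_add[OF endomorphism_bracket_left] endomorphism_add[OF endomorphism_bracket]
      endomorphism_diff[OF endomorphism_bracket_left] endomorphism_diff[OF endomorphism_bracket]
      endomorphism_scale[OF endomorphism_bracket_left] endomorphism_scale[OF endomorphism_bracket]
      endomorphism_zero[OF endomorphism_bracket_left] endomorphism_zero[OF endomorphism_bracket])+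

lemma bracket_anticommute: "bracket x y = - bracket y x"
proof -
  have "bracket (x + y) (x + y) = 0" by (rule bracket_self)
  then have "bracket x y + bracket y x = 0"
    by (simp add: bracket_simps bracket_self[of x] bracket_self[of y] add.commute)
  then show ?thesis by (simp add: eq_neg_iff_add_eq_0)
qed

lemma bracket_derivation:
  "bracket x (bracket y z) = bracket (bracket x y) z + bracket y (bracket x z)"
proof -
  have "bracket y (bracket z x) = - bracket y (bracket x z)"
    by (metis bracket_anticommute bracket_simps(8) diff_0 bracket_simps(4))
  moreover have "bracket z (bracket x y) = - bracket (bracket x y) z"
    by (rule bracket_anticommute)
  ultimately show ?thesis
    using jacobi[of x y z] by (simp add: algebra_simps)
qed

definition half_derivation :: "('a \<Rightarrow> 'a) \<Rightarrow> bool"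
  where "half_derivation D \<longleftrightarrow> endomorphism D \<and>
    (\<forall>x y. scale 2 (D (bracket x y)) = bracket (D x) y + bracket x (D y))"

lemma half_derivationD:
  assumes "half_derivation D"
  shows "endomorphism D"
    and "scale 2 (D (bracket x y)) = bracket (D x) y + bracket x (D y)"
  using assms by (auto simp: half_derivation_def)

lemma scale_2: "scale 2 x = x + x"
  using scale_left_distrib[of 1 1 x] by simp

lemma half_derivation_diff_scale:
  assumes D: "half_derivation D" and E: "half_derivation E"
  shows "half_derivation (\<lambda>x. E x - scale c (D x))"
  unfolding half_derivation_def
proof (intro conjI allI)
  show "endomorphism (\<lambda>x. E x - scale c (D x))"
    using half_derivationD(1)[OF D] half_derivationD(1)[OF E]
    by (intro endomorphismI)
       (simp_all add: endomorphism_add endomorphism_scale scale_right_distrib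
          scale_right_diff_distrib mult.commute)
  fix x y
  have "scale 2 (E (bracket x y) - scale c (D (bracket x y)))
      = scale 2 (E (bracket x y)) - scale c (scale 2 (D (bracket x y)))"
    by (simp add: scale_right_diff_distrib mult.commute)
  also have "\<dots> = bracket (E x - scale c (D x)) y + bracket x (E y - scale c (D y))"
    unfolding half_derivationD(2)[OF D] half_derivationD(2)[OF E]
    by (simp add: bracket_simps scale_right_distrib algebra_simps)
  finally show "scale 2 (E (bracket x y) - scale c (D (bracket x y)))
      = bracket (E x - scale c (D x)) y + bracket x (E y - scale c (D y))" .
qed

lemma half_derivation_kernel_bracket:
  assumes D: "half_derivation D" and "D x = 0"
  shows "bracket x (D y) = scale 2 (D (bracket x y))"
  using half_derivationD(2)[OF D, of x y] assms(2) by (simp add: bracket_simps)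

text \<open>
  The commutator of the derivation \<open>ad x\<close> with \<open>D\<close> is a half-derivation, and by the preceding lemma this
  commutator is \<open>D \<circ> ad x\<close> itself when \<open>D x = 0\<close>. Expanding \<open>D [x,[u,v]]\<close> once with the half-derivation
  rule outermost and once with \<open>ad x\<close> outermost shows that the unwanted mixed terms \<open>R\<close> vanish.
\<close>

lemma half_derivation_ad:
  assumes D: "half_derivation D" and x: "D x = 0"
  shows "half_derivation (\<lambda>y. D (bracket x y))"
  unfolding half_derivation_def
proof (intro conjI allI)
  note lin = half_derivationD(1)[OF D]
  let ?E = "\<lambda>y. D (bracket x y)"
  show "endomorphism ?E"
    using lin by (intro endomorphismI) (simp_all add: bracket_simps endomorphism_add endomorphism_scale)
  fix u v
  define R where "R = bracket (D u) (bracket x v) + bracket (bracket x u) (D v)"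
  define Q where "Q = bracket (?E u) v + bracket u (?E v)"
  have kb: "bracket x (D y) = ?E y + ?E y" for y
    using half_derivation_kernel_bracket[OF assms] by (simp add: scale_2)
  have half: "D (bracket y z) + D (bracket y z) = bracket (D y) z + bracket y (D z)" for y z
    using half_derivationD(2)[OF D, of y z] by (simp add: scale_2)
  have one: "?E (bracket u v) + ?E (bracket u v) = Q + R"
    using half[of "bracket x u" v] half[of u "bracket x v"]
    by (simp add: bracket_derivation[of x u v] endomorphism_add[OF lin] Q_def R_def algebra_simps)
  have "bracket x (D (bracket u v) + D (bracket u v))
      = bracket (bracket x (D u)) v + bracket (D u) (bracket x v)
        + (bracket (bracket x u) (D v) + bracket u (bracket x (D v)))"
    unfolding half bracket_simps(2)
    by (simp add: bracket_derivation[of x "D u" v] bracket_derivation[of x u "D v"])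
  then have "(?E (bracket u v) + ?E (bracket u v)) + (?E (bracket u v) + ?E (bracket u v))
      = Q + Q + R"
    by (simp add: kb bracket_simps Q_def R_def algebra_simps)
  with one have "R = 0" by (simp add: algebra_simps)
  with one show "scale 2 (?E (bracket u v)) = bracket (?E u) v + bracket u (?E v)"
    by (simp add: scale_2 Q_def)
qed

text \<open>
  Since \<open>D\<close> identifies \<open>L / ker D\<close> with its range, and \<open>[x, D u] = 2 D [x,u]\<close>, an eigenvector \<open>D t\<close> of
  \<open>ad x\<close> on the range gives a vector \<open>t\<close> outside \<open>ker D\<close> that is killed by \<open>D \<circ> ad x - c D\<close> for half
  the eigenvalue. This operator kills \<open>ker D\<close> too, and maximality makes it zero.
\<close>

lemma kernel_acts_by_scalar:
  assumes D: "half_derivation D" and sq: "\<And>x. D (D x) = 0" and nz: "D t0 \<noteq> 0"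
    and max: "\<And>E. half_derivation E \<Longrightarrow> (\<forall>x. E (E x) = 0) \<Longrightarrow> (\<exists>x. E x \<noteq> 0) \<Longrightarrow>
                dim {x. E x = 0} \<le> dim {x. D x = 0}"
    and x: "D x = 0"
  obtains c where "\<And>u. D (bracket x u) = scale c (D u)"
proof -
  note lin = half_derivationD(1)[OF D]
  let ?E = "\<lambda>u. D (bracket x u)"
  note hdE = half_derivation_ad[OF D x]
  have E_D: "?E (D y) = 0" for y
    by (simp add: half_derivation_kernel_bracket[OF D x] endomorphism_scale[OF lin] sq)
  have E_ker: "?E y = 0" if "D y = 0" for y
  proof -
    have "scale 2 (D (bracket x y)) = 0"
      using half_derivationD(2)[OF D, of x y] x that by (simp add: bracket_simps)
    then show ?thesis by simp
  qed
  have "bracket x v \<in> range D" if "v \<in> range D" for v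
  proof -
    from that obtain y where "v = D y" by blast
    then have "bracket x v = D (scale 2 (bracket x y))"
      using half_derivation_kernel_bracket[OF D x] endomorphism_scale[OF lin] by simp
    then show ?thesis by blast
  qed
  then obtain a w where w: "w \<in> range D" "w \<noteq> 0" "bracket x w = scale a w"
    using eigenvector_exists[OF endomorphism_bracket subspace_range[OF lin], of x] nz
    by (metis rangeI)
  then obtain t where t: "w = D t" by blast
  define c where "c = a / 2"
  let ?G = "\<lambda>u. ?E u - scale c (D u)"
  have G: "half_derivation ?G"
    by (rule half_derivation_diff_scale[OF D hdE])
  have G_sq: "?G (?G u) = 0" for u
    by (simp add: bracket_simps endomorphism_diff[OF lin] endomorphism_scale[OF lin] E_D sq)
  have "scale 2 (?E t) = scale 2 (scale c (D t))"
    using half_derivation_kernel_bracket[OF D x, of t] w t by (simp add: c_def)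
  then have "?E t = scale c (D t)"
    by (rule scale_left_imp_eq[rotated]) simp
  then have "?G t = 0" by simp
  have "\<not> (half_derivation ?G \<and> (\<forall>x. ?G (?G x) = 0) \<and> (\<exists>x. ?G x \<noteq> 0))"
    by (rule kernel_maximal_imp_not[where T = "\<lambda>E. E" and w = D and t = t
          and P = "\<lambda>E. half_derivation E \<and> (\<forall>x. E (E x) = 0) \<and> (\<exists>x. E x \<noteq> 0)"])
       (use max lin half_derivationD(1)[OF G] E_ker \<open>?G t = 0\<close> t w in auto)
  with G G_sq have "?G u = 0" for u by blast
  then show thesis using that[of c] by simp
qed

text \<open>
  The union of this chain is the Lie ideal generated by the range of \<open>D\<close>. The chain starts one step before
  the range, at \<open>{0}\<close>, so that ``lowering the filtration'' has a meaning on the range itself.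
\<close>

primrec ideal_filtration :: "('a \<Rightarrow> 'a) \<Rightarrow> nat \<Rightarrow> 'a set"
  where
    "ideal_filtration D 0 = {0}"
  | "ideal_filtration D (Suc n) =
      span (range D \<union> {bracket u y | u y. y \<in> ideal_filtration D n})"

lemma subspace_ideal_filtration: "subspace (ideal_filtration D n)"
  by (cases n) auto

lemma ideal_filtration_mono: "ideal_filtration D n \<subseteq> ideal_filtration D (Suc n)"
proof (induction n)
  case 0
  then show ?case by (simp add: span_zero)
next
  case (Suc n)
  have "ideal_filtration D (Suc n)
      \<subseteq> span (range D \<union> {bracket u y | u y. y \<in> ideal_filtration D (Suc n)})"
    using Suc by (simp only: ideal_filtration.simps(2)[of D n]) (intro span_mono, blast)
  then show ?case by (simp only: ideal_filtration.simps(2)[of D "Suc n"])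
qed

lemma range_subset_ideal_filtration: "range D \<subseteq> ideal_filtration D (Suc n)"
  by (auto intro: span_base)

lemma bracket_ideal_filtration:
  "y \<in> ideal_filtration D n \<Longrightarrow> bracket u y \<in> ideal_filtration D (Suc n)"
  by (auto intro: span_base)

lemma ideal_filtration_induct [consumes 1, case_names range bracket subspace]:
  assumes "y \<in> ideal_filtration D (Suc n)"
    and "\<And>t. P (D t)" "\<And>u y. y \<in> ideal_filtration D n \<Longrightarrow> P (bracket u y)" "subspace {y. P y}"
  shows "P y"
proof -
  have "ideal_filtration D (Suc n) \<subseteq> {y. P y}"
    unfolding ideal_filtration.simps by (intro span_minimal) (use assms in auto)
  with assms(1) show ?thesis by blast
qed

lemma endomorphism_bracket_diff_scale: "endomorphism (\<lambda>y. bracket x y - scale c y)"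
  by (rule endomorphismI)
     (simp_all add: bracket_simps scale_right_distrib scale_right_diff_distrib mult.commute)

text \<open>
  By the derivation rule for \<open>[x,[u,y]]\<close>, bracketing with one more \<open>u\<close> adds the scalar \<open>c\<close> by which \<open>x\<close>
  acts on \<open>u\<close> modulo \<open>ker D\<close>. The error term of \<open>[x,u]\<close> lies in \<open>ker D\<close>, so the induction hypothesis,
  applied to it with its own scalar, shows that it preserves the lower layer. This is why \<open>x\<close> and \<open>c\<close>
  vary in the induction.
\<close>

lemma scalar_action_on_filtration:
  assumes D: "half_derivation D"
    and scalars: "\<And>x. D x = 0 \<Longrightarrow> \<exists>c. \<forall>u. D (bracket x u) = scale c (D u)"
    and "D x = 0" "\<And>u. D (bracket x u) = scale c (D u)"
    and "y \<in> ideal_filtration D (Suc n)"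
  shows "bracket x y - scale (of_nat (n + 2) * c) y \<in> ideal_filtration D n"
  using assms(3-5)
proof (induction n arbitrary: x c y)
  case 0
  note lin = half_derivationD(1)[OF D]
  show ?case
    using 0(3)
  proof (induction rule: ideal_filtration_induct)
    case (range t)
    show ?case
      using half_derivation_kernel_bracket[OF D 0(1), of t] 0(2)[of t] by simp
  next
    case (bracket u y)
    then show ?case by (simp add: bracket_simps)
  next
    case subspace
    show ?case
      using subspace_kernel[OF endomorphism_bracket_diff_scale[of x "of_nat (0 + 2) * c"]] by simp
  qed
next
  case (Suc n)
  note lin = half_derivationD(1)[OF D]
  let ?F = "ideal_filtration D"
  note F = subspace_ideal_filtration[of D]
  show ?case
    using Suc.prems(3)
  proof (induction rule: ideal_filtration_induct)
    case (range t)
    have "bracket x (D t) = scale (2 * c) (D t)"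
      using half_derivation_kernel_bracket[OF D Suc.prems(1), of t] Suc.prems(2)[of t] by simp
    then have "bracket x (D t) - scale (of_nat (Suc n + 2) * c) (D t)
        = scale (2 * c - of_nat (Suc n + 2) * c) (D t)"
      by (simp add: scale_left_diff_distrib)
    then show ?case
      using range_subset_ideal_filtration[of D n] F subspace_scale by (metis rangeI subsetD)
  next
    case (bracket u y)
    define k where "k = bracket x u - scale c u"
    have "D k = 0"
      by (simp add: k_def endomorphism_diff[OF lin] endomorphism_scale[OF lin] Suc.prems)
    from scalars[OF this] obtain d where d: "\<And>u. D (bracket k u) = scale d (D u)"
      by blast
    have "bracket k y - scale (of_nat (n + 2) * d) y \<in> ?F (Suc n)"
      using Suc.IH[OF \<open>D k = 0\<close> d bracket] ideal_filtration_mono by blast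
    from subspace_add[OF F this subspace_scale[OF F bracket, of "of_nat (n + 2) * d"]]
    have ky: "bracket k y \<in> ?F (Suc n)" by simp
    define r where "r = bracket x y - scale (of_nat (n + 2) * c) y"
    have "r \<in> ?F n"
      unfolding r_def by (rule Suc.IH[OF Suc.prems(1,2) bracket])
    then have ur: "bracket u r \<in> ?F (Suc n)"
      by (rule bracket_ideal_filtration)
    have xu: "bracket x u = scale c u + k" and xy: "bracket x y = scale (of_nat (n + 2) * c) y + r"
      by (simp_all add: k_def r_def)
    have "bracket x (bracket u y) = scale (c + of_nat (n + 2) * c) (bracket u y) + (bracket k y + bracket u r)"
      unfolding bracket_derivation[of x u y] xu xy
      by (simp only: bracket_simps scale_left_distrib) (simp add: algebra_simps)
    also have "c + of_nat (n + 2) * c = of_nat (Suc n + 2) * c"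
      by (simp add: algebra_simps)
    finally have "bracket x (bracket u y) - scale (of_nat (Suc n + 2) * c) (bracket u y)
        = bracket k y + bracket u r"
      by simp
    then show ?case
      using subspace_add[OF F ky ur] by simp
  next
    case subspace
    note T = endomorphism_bracket_diff_scale[of x "of_nat (Suc n + 2) * c"]
    show ?case
      using F[of "Suc n"] unfolding subspace_def mem_Collect_eq
      by (simp only: endomorphism_add[OF T] endomorphism_scale[OF T] endomorphism_zero[OF T])
        blast
  qed
qed

text \<open>
  Once \<open>y\<close> is known to lie in \<open>ker D\<close>, apply the scalar action to the pair \<open>(y, y)\<close>: as \<open>[y,y] = 0\<close>, a
  nonzero multiple of \<open>c y\<close> lies in the lower layer, whose elements act trivially on \<open>L / ker D\<close>. Either
  way \<open>y\<close> acts trivially, and therefore \<open>[u,y]\<close> lies in \<open>ker D\<close>, which starts the next layer.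
\<close>

lemma filtration_acts_trivially:
  assumes D: "half_derivation D" and sq: "\<And>x. D (D x) = 0"
    and scalars: "\<And>x. D x = 0 \<Longrightarrow> \<exists>c. \<forall>u. D (bracket x u) = scale c (D u)"
    and "y \<in> ideal_filtration D n"
  shows "D y = 0 \<and> (\<forall>u. D (bracket y u) = 0)"
  using assms(4)
proof (induction n arbitrary: y)
  case 0
  then show ?case
    using endomorphism_zero[OF half_derivationD(1)[OF D]] by (simp add: bracket_simps)
next
  case (Suc n)
  note lin = half_derivationD(1)[OF D]
  have Dy: "D y = 0"
    using Suc.prems
  proof (induction rule: ideal_filtration_induct)
    case (range t)
    show ?case by (rule sq)
  next
    case (bracket u z)
    with Suc.IH have "D (bracket z u) = 0" by blast
    moreover have "D (bracket u z) = D (0 - bracket z u)"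
      by (simp flip: bracket_anticommute)
    ultimately show ?case
      by (simp only: endomorphism_diff[OF lin] endomorphism_zero[OF lin]) simp
  next
    case subspace
    show ?case by (rule subspace_kernel[OF lin])
  qed
  then obtain c where c: "\<And>u. D (bracket y u) = scale c (D u)"
    using scalars by blast
  have mem: "scale (- (of_nat (n + 2) * c)) y \<in> ideal_filtration D n"
    using scalar_action_on_filtration[OF D scalars Dy c Suc.prems] by (simp add: bracket_self)
  have "y \<in> ideal_filtration D n" if "c \<noteq> 0"
  proof -
    have ne: "- (of_nat (n + 2) * c) \<noteq> 0"
      using that of_nat_neq_0[of "Suc n", where 'a = complex] by simp
    have "scale (inverse (- (of_nat (n + 2) * c))) (scale (- (of_nat (n + 2) * c)) y) = y"
      by (simp only: scale_scale left_inverse[OF ne] scale_one)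
    with subspace_scale[OF subspace_ideal_filtration mem] show ?thesis
      by metis
  qed
  with Suc.IH c Dy show ?case by (cases "c = 0") auto
qed

lemma derived_series_ideal_filtration:
  assumes D: "half_derivation D" and sq: "\<And>x. D (D x) = 0"
    and scalars: "\<And>x. D x = 0 \<Longrightarrow> \<exists>c. \<forall>u. D (bracket x u) = scale c (D u)"
  shows "derived_series (ideal_filtration D N) m \<subseteq> ideal_filtration D (N - m)"
proof (induction m)
  case 0
  show ?case by simp
next
  case (Suc m)
  have "bracket x y \<in> ideal_filtration D (N - Suc m)"
    if "x \<in> ideal_filtration D (N - m)" "y \<in> ideal_filtration D (N - m)" for x y
  proof (cases "N - m")
    case 0
    with that show ?thesis by (simp add: bracket_simps)
  next
    case (Suc k)
    have "D x = 0" "\<And>u. D (bracket x u) = scale 0 (D u)"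
      using filtration_acts_trivially[OF D sq scalars that(1)] by simp_all
    from scalar_action_on_filtration[OF D scalars this, of y k] that(2) Suc
    have "bracket x y \<in> ideal_filtration D k" by simp
    moreover have "N - Suc m = k" using Suc by simp
    ultimately show ?thesis by simp
  qed
  with Suc.IH show ?case
    unfolding derived_series.simps
    by (intro span_minimal subspace_ideal_filtration) blast
qed

text \<open>
  The filtration stabilizes at a nonzero ideal, whose derived series descends at least as fast as the
  filtration.
\<close>

theorem square_zero_half_derivation_vanishes:
  assumes ss: semisimple and D0: "half_derivation D0" and sq0: "\<And>x. D0 (D0 x) = 0"
  shows "D0 x = 0"
proof (rule ccontr)
  let ?P = "\<lambda>E. half_derivation E \<and> (\<forall>x. E (E x) = 0) \<and> (\<exists>x. E x \<noteq> 0)"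
  assume "D0 x \<noteq> 0"
  with D0 sq0 have "?P D0" by blast
  then obtain D where P: "?P D"
    and max: "\<And>E. ?P E \<Longrightarrow> dim {x. E x = 0} \<le> dim {x. D x = 0}"
    by (rule maximal_kernel[where T = "\<lambda>E. E" and P = ?P]) blast
  from P obtain t where D: "half_derivation D" and sq: "\<And>x. D (D x) = 0" and t: "D t \<noteq> 0"
    by blast
  have scalars: "\<exists>c. \<forall>u. D (bracket x u) = scale c (D u)" if "D x = 0" for x
    by (rule kernel_acts_by_scalar[OF D sq t _ that]) (use max in blast)+
  let ?F = "ideal_filtration D"
  obtain N where N: "?F (Suc N) = ?F N"
    by (rule ascending_chain_stabilizes[of ?F, OF subspace_ideal_filtration ideal_filtration_mono])
  have "lie_ideal (?F N)"
    unfolding lie_ideal_def using subspace_ideal_filtration bracket_ideal_filtration[of _ D N] N by auto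
  moreover have "derived_series (?F N) N = {0}"
  proof
    show "derived_series (?F N) N \<subseteq> {0}"
      using derived_series_ideal_filtration[OF D sq scalars, of N N] by simp
    show "{0} \<subseteq> derived_series (?F N) N"
      by (cases N) (simp_all add: span_zero)
  qed
  then have "solvable (?F N)"
    unfolding solvable_def by blast
  ultimately have "?F N = {0}"
    using ss unfolding semisimple_def by blast
  moreover have "D t \<in> ?F N"
    using range_subset_ideal_filtration[of D N] N by blast
  ultimately show False using t by simp
qed

section \<open>Transposed Poisson products\<close>

text \<open>
  Associativity makes \<open>(mult z)\<^sup>2\<close> the operator of \<open>z \<cdot> z\<close>, so elements of square zero act as zero. It also
  makes \<open>w \<cdot> L\<close> closed under products, which puts the idempotent into \<open>w \<cdot> L\<close>.
\<close>

theorem no_nontrivial_mult: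
  fixes mult :: "'a \<Rightarrow> 'a \<Rightarrow> 'a"
  assumes ss: semisimple and tp: "transposed_poisson_structure scale bracket mult"
  shows "mult x y = 0"
proof (rule ccontr)
  interpret tp: transposed_poisson_structure scale bracket mult by (rule tp)
  note comm = tp.mult_commute and assoc = tp.mult_assoc
  have lin: "endomorphism (mult z)" for z
    using tp.mult_bilinear by (simp add: complex_bilinear_def)
  have scale_left: "mult (scale c u) v = scale c (mult u v)" for c u v
    by (metis comm endomorphism_scale lin)
  have diff_left: "mult (u - v) z = mult u z - mult v z" for u v z
    by (metis comm endomorphism_diff lin)
  note scale_right = endomorphism_scale[OF lin] and zero_right = endomorphism_zero[OF lin]
  have hd: "half_derivation (mult z)" for z
    unfolding half_derivation_def using lin tp.transposed_leibniz by blast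
  have reduced: "mult z u = 0" if "\<And>v. mult (mult z z) v = 0" for z u
    by (rule square_zero_half_derivation_vanishes[OF ss hd]) (use that assoc in metis)
  let ?P = "\<lambda>z. \<exists>v. mult z v \<noteq> 0"
  assume "mult x y \<noteq> 0"
  then have "?P x" by blast
  then obtain w where "?P w" and max: "\<And>z. ?P z \<Longrightarrow> dim {x. mult z x = 0} \<le> dim {x. mult w x = 0}"
    by (rule maximal_kernel[where T = mult and P = ?P]) blast
  have kills: "mult z v = 0" if "\<And>x. mult w x = 0 \<Longrightarrow> mult z x = 0" "mult z t = 0" "mult w t \<noteq> 0" for z t v
    using kernel_maximal_imp_not[of ?P mult w z t, OF max lin lin that] by blast
  from \<open>?P w\<close> obtain v0 where v0: "mult w v0 \<noteq> 0" by blast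
  obtain a m where m: "m \<in> range (mult w)" "m \<noteq> 0" "mult w m = scale a m"
    by (rule eigenvector_exists[where f = "mult w" and v = "mult w v0", OF lin subspace_range[OF lin]])
      (use v0 in auto)
  then obtain t where t: "m = mult w t" by blast
  \<comment> \<open>Multiplication by \<open>w\<cdot>w - a w\<close> kills the annihilator of \<open>w\<close> and the vector \<open>t\<close>.\<close>
  have w_scalar: "mult w (mult w v) = scale a (mult w v)" for v
  proof -
    let ?z = "mult w w - scale a w"
    have z: "mult ?z u = mult w (mult w u) - scale a (mult w u)" for u
      by (simp add: diff_left scale_left assoc)
    have "mult ?z v = 0"
    proof (rule kills[of _ t])
      show "mult ?z t = 0" unfolding z using m(3) t by simp
      show "mult w t \<noteq> 0" using m(2) t by simp
    qed (simp add: z zero_right)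
    with z show ?thesis by simp
  qed
  have "a \<noteq> 0"
  proof
    assume "a = 0"
    then have "mult (mult w w) v = 0" for v
      by (simp add: assoc w_scalar)
    with reduced v0 show False by blast
  qed
  \<comment> \<open>While \<open>w / a\<close> already acts as the identity on the range of \<open>mult w\<close>, its square also lies in it.\<close>
  define e where "e = scale (1 / a^2) (mult w w)"
  have e_mult: "mult e v = scale (1 / a) (mult w v)" for v
    using \<open>a \<noteq> 0\<close> by (simp add: e_def scale_left assoc w_scalar power2_eq_square)
  have e_range: "mult e (mult w v) = mult w v" for v
    using \<open>a \<noteq> 0\<close> by (simp add: e_mult w_scalar)
  have w_e: "mult w e = scale a e"
    by (simp add: e_def scale_right w_scalar mult.commute)
  \<comment> \<open>If \<open>y = w\<cdot>v\<close> has the eigenvalue \<open>b\<close> on the range, then \<open>y - b e\<close> kills too much, and \<open>w\<close> is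
      injective on the range, so \<open>y = b e\<close>.\<close>
  have line: "\<exists>b. mult w v = scale b e" for v
  proof -
    let ?y = "mult w v"
    have y_range: "mult ?y u \<in> range (mult w)" for u
      by (simp add: assoc)
    obtain b n where n: "n \<in> range (mult w)" "n \<noteq> 0" "mult ?y n = scale b n"
      by (rule eigenvector_exists[where f = "mult ?y" and v = "mult w v0",
            OF lin subspace_range[OF lin[of w]]])
        (use v0 y_range in auto)
    have ne: "mult e n = n" and wn: "mult w n \<noteq> 0"
      using n \<open>a \<noteq> 0\<close> e_range w_scalar by auto
    let ?z = "?y - scale b e"
    have z: "mult ?z u = mult ?y u - scale b (mult e u)" for u
      by (simp add: diff_left scale_left)
    have "mult ?z w = 0"
    proof (rule kills[of _ n])
      show "mult ?z u = 0" if "mult w u = 0" for u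
      proof -
        have "mult ?y u = mult v (mult w u)" by (metis assoc comm)
        with that show ?thesis by (simp add: z e_mult zero_right)
      qed
      show "mult ?z n = 0" using z ne n(3) by simp
    qed (rule wn)
    moreover have "mult ?z w = scale a ?z"
      using w_scalar[of v] w_e
      by (simp add: comm[of _ w] endomorphism_diff[OF lin] scale_right scale_right_diff_distrib mult.commute)
    ultimately have "?z = 0" using \<open>a \<noteq> 0\<close> by simp
    then show ?thesis by (metis eq_iff_diff_eq_0)
  qed
  have "e \<noteq> 0"
    using line[of v0] v0 by auto
  have central: "bracket u e = 0" for u
  proof -
    have e_e: "mult e e = e"
      using \<open>a \<noteq> 0\<close> by (simp add: e_mult w_e)
    obtain b where b: "mult e u = scale b e"
      using line[of u] by (metis e_mult scale_scale)
    define n where "n = mult e (bracket e u)"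
    have half: "scale 2 n = bracket e u"
      using tp.transposed_leibniz[of e e u] by (simp add: n_def e_e b bracket_simps bracket_self)
    have idem: "mult e n = n"
      unfolding n_def by (simp add: e_e flip: assoc)
    have "n + n = n"
      using arg_cong[OF half, of "mult e"] by (simp add: scale_right idem flip: n_def scale_2)
    with half show ?thesis
      using bracket_anticommute[of u e] by simp
  qed
  have central_span: "bracket u y = 0" if "y \<in> span {e}" for u y
    using that central by (auto simp: span_singleton bracket_simps)
  have "lie_ideal (span {e})"
    unfolding lie_ideal_def by (auto simp: central_span span_zero)
  moreover have "derived_series (span {e}) 1 = {0}"
  proof -
    have "{bracket x y | x y. x \<in> span {e} \<and> y \<in> span {e}} = {0}"
      using central_span span_zero by (auto intro!: exI[of _ 0])
    then show ?thesis by (simp add: span_singleton)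
  qed
  then have "solvable (span {e})"
    unfolding solvable_def by blast
  ultimately have "span {e} = {0}"
    using ss unfolding semisimple_def by blast
  with \<open>e \<noteq> 0\<close> span_base[of e "{e}"] show False by simp
qed

end

theorem corollary8:
  fixes scale :: "complex \<Rightarrow> 'a::ab_group_add \<Rightarrow> 'a"
    and bracket :: "'a \<Rightarrow> 'a \<Rightarrow> 'a"
  assumes "complex_lie_algebra scale bracket"
    and "\<exists>Basis. finite_dimensional_vector_space scale Basis"
    and "complex_lie_algebra.semisimple scale bracket"
  shows "\<not> (\<exists>mult. transposed_poisson_structure scale bracket mult \<and>
                  transposed_poisson_structure.nontrivial bracket mult)"
proof -
  from assms(2) obtain Basis where Basis: "finite_dimensional_vector_space scale Basis"
    by blast
  interpret finite_dimensional_lie_algebra scale bracket Basis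
    by (intro finite_dimensional_lie_algebra.intro finite_dimensional_complex_space.intro assms(1) Basis)
  show ?thesis
    using no_nontrivial_mult[OF assms(3)] transposed_poisson_structure.nontrivial_def by blast
qed

end
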